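(* Let $\mathbb{M}$ be a $d$-dimensional, compact, complete, smooth Riemannian manifold, let $\kappa\colon\mathbb{M}\times\mathbb{M}\to\mathbb{R}$ be a positive definite kernel, and let $\rho,C_1,\nu>0$ and $0<c_1<c_2$. Let $\Xi\subset\mathbb{M}$ be a finite set with separation radius $q$ and mesh ratio $\rho$, let $S(\kappa,\Xi):=\mathrm{span}_{\xi\in\Xi}\kappa(\cdot,\xi)$, and suppose $S(\kappa,\Xi)$ has a basis $(v_\xi)_{\xi\in\Xi}$ of continuous functions satisfying: (i) (Stability) for all $1\le p\le\infty$ and all coefficients $(A_\xi)_{\xi\in\Xi}$, $$c_1q^{d/p}\Big(\sum_{\xi\in\Xi}|A_\xi|^p\Big)^{1/p}\le\Big\|\sum_{\xi\in\Xi}A_\xi v_\xi\Big\|_{L_p(\mathbb{M})}\le c_2q^{d/p}\Big(\sum_{\xi\in\Xi}|A_\xi|^p\Big)^{1/p},$$ with the usual modification ($\max_{\xi}|A_\xi|$ and $q^{d/\infty}=1$) for $p=\infty$; (ii) (Localization) $|v_\xi(x)|\le C_1\exp\left(-\nu\,\frac{\min(\mathrm{dist}(x,\xi),\mathrm{r}_{\mathbb{M}})}{q}\right)$ for all $\xi\in\Xi$, $x\in\mathbb{M}$. Then there is a constant $\mathcal{K}\le\max_{1\le p\le\infty}\|T_\Xi\|_{L_p\to L_p}<\infty$, where $T_\Xi$ is the $L_2$ projector onto $S(\kappa,\Xi)$, such that for all $1\le p\le\infty$ and $f\in L_p(\mathbb{M})$, $$\|f-T_\Xi f\|_p\le(1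+\mathcal{K})\,\mathrm{dist}_p\bigl(f,S(\kappa,\Xi)\bigr).$$
   Context: For a finite set $\Xi\subset\mathbb{M}$: the mesh norm is $h:=\sup_{x\in\mathbb{M}}\mathrm{dist}(x,\Xi)$, the separation radius is $q:=\frac12\inf_{\xi\ne\zeta\in\Xi}\mathrm{dist}(\xi,\zeta)$, and the mesh ratio is $\rho:=h/q$, where $\mathrm{dist}$ is the Riemannian distance. $\mathrm{r}_{\mathbb{M}}>0$ is the injectivity radius of $\mathbb{M}$. $L_p(\mathbb{M})$ is taken with respect to the Riemannian measure, $\langle\cdot,\cdot\rangle$ is the $L_2$ inner product. The $L_2$ projector $T_\Xi$ maps $f\in L_1(\mathbb{M})$ to the unique element $T_\Xi f\in S(\kappa,\Xi)$ with $\langle T_\Xi f,g\rangle=\langle f,g\rangle$ for all $g\in S(\kappa,\Xi)$. $\mathrm{dist}_p(f,S):=\inf_{s\in S}\|f-s\|_p$. *)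

theory Defs
  imports "HOL-Probability.Essential_Supremum"
begin

section \<open>Smooth maps between open subsets of Euclidean spaces\<close>

text \<open>The sets are meant to be open: derivatives are taken at \<open>x\<close>, not within \<open>S\<close>.\<close>

fun Ck_on :: "nat \<Rightarrow> 'a::real_normed_vector set \<Rightarrow> ('a \<Rightarrow> 'b::real_normed_vector) \<Rightarrow> bool" where
  "Ck_on 0 S f \<longleftrightarrow> continuous_on S f"
| "Ck_on (Suc k) S f \<longleftrightarrow>
     (\<forall>x\<in>S. f differentiable at x) \<and> (\<forall>v. Ck_on k S (\<lambda>x. frechet_derivative f (at x) v))"

definition smooth_on :: "'a::real_normed_vector set \<Rightarrow> ('a \<Rightarrow> 'b::real_normed_vector) \<Rightarrow> bool" where
  "smooth_on S f \<longleftrightarrow> (\<forall>k. Ck_on k S f)"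

section \<open>Smooth Riemannian manifolds\<close>

text \<open>
  The underlying topological manifold is a whole type \<open>'m\<close>; the dimension \<open>d\<close> is \<open>CARD('n)\<close>,
  so \<open>d \<ge> 1\<close>. Connectedness is not required.
  A chart is a pair \<open>(U, \<phi>)\<close>; the values of \<open>\<phi>\<close> outside \<open>U\<close> are irrelevant.
  The metric is given, for each chart, by the matrix of its coefficients as a function of the
  coordinates.
\<close>

type_synonym ('m, 'n) chart = "'m set \<times> ('m \<Rightarrow> real ^ 'n)"

record ('m, 'n) riemannian =
  atlas :: "('m, 'n) chart set"
  gmat :: "('m, 'n) chart \<Rightarrow> real ^ 'n \<Rightarrow> real ^ 'n ^ 'n"

definition is_chart :: "('m::topological_space, 'n::finite) chart \<Rightarrow> bool" where
  "is_chart c \<longleftrightarrow> (case c of (U, \<phi>) \<Rightarrow>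
     open U \<and> open (\<phi> ` U) \<and> homeomorphism U (\<phi> ` U) \<phi> (inv_into U \<phi>))"

definition transition :: "('m, 'n::finite) chart \<Rightarrow> ('m, 'n) chart \<Rightarrow> real ^ 'n \<Rightarrow> real ^ 'n" where
  "transition c c' = snd c' \<circ> inv_into (fst c) (snd c)"

definition riemannian_manifold ::
  "('m::{t2_space, second_countable_topology}, 'n::finite) riemannian \<Rightarrow> bool" where
  "riemannian_manifold M \<longleftrightarrow>
     (\<forall>c\<in>atlas M. is_chart c) \<and>
     (\<Union>c\<in>atlas M. fst c) = UNIV \<and>
     (\<forall>c\<in>atlas M. \<forall>c'\<in>atlas M. smooth_on (snd c ` (fst c \<inter> fst c')) (transition c c')) \<and>
     (\<forall>c\<in>atlas M. smooth_on (snd c ` fst c) (gmat M c)) \<and>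
     (\<forall>c\<in>atlas M. \<forall>x\<in>snd c ` fst c.
        transpose (gmat M c x) = gmat M c x \<and> (\<forall>v. v \<noteq> 0 \<longrightarrow> v \<bullet> (gmat M c x *v v) > 0)) \<and>
     (\<forall>c\<in>atlas M. \<forall>c'\<in>atlas M. \<forall>x\<in>snd c ` (fst c \<inter> fst c').
        gmat M c x = transpose (jacobian (transition c c') (at x))
                       ** gmat M c' (transition c c' x)
                       ** jacobian (transition c c') (at x))"

text \<open>
  A tangent vector at \<open>p\<close> is represented by its coordinates in the chart \<open>chart_at M p\<close>;
  the quantities built from it below do not depend on which chart is chosen.
\<close>

definition chart_at :: "('m, 'n::finite) riemannian \<Rightarrow> 'm \<Rightarrow> ('m, 'n) chart" where
  "chart_at M p = (SOME c. c \<in> atlas M \<and> p \<in> fst c)"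

definition tangent_norm :: "('m, 'n::finite) riemannian \<Rightarrow> 'm \<Rightarrow> real ^ 'n \<Rightarrow> real" where
  "tangent_norm M p v =
     (let c = chart_at M p in sqrt (v \<bullet> (gmat M c (snd c p) *v v)))"

definition velocity :: "('m, 'n::finite) riemannian \<Rightarrow> (real \<Rightarrow> 'm) \<Rightarrow> real \<Rightarrow> real ^ 'n" where
  "velocity M \<gamma> t = vector_derivative (snd (chart_at M (\<gamma> t)) \<circ> \<gamma>) (at t)"

subsection \<open>Riemannian distance\<close>

text \<open>Same convention as the library's \<open>piecewise_C1_differentiable_on\<close>, read in charts.\<close>

definition piecewise_C1_curve ::
  "('m::topological_space, 'n::finite) riemannian \<Rightarrow> (real \<Rightarrow> 'm) \<Rightarrow> bool" where
  "piecewise_C1_curve M \<gamma> \<longleftrightarrow> continuous_on {0..1} \<gamma> \<and>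
     (\<exists>F. finite F \<and> (\<forall>c\<in>atlas M.
        (snd c \<circ> \<gamma>) C1_differentiable_on {t \<in> {0..1} - F. \<gamma> t \<in> fst c}))"

definition curve_length :: "('m, 'n::finite) riemannian \<Rightarrow> (real \<Rightarrow> 'm) \<Rightarrow> ennreal" where
  "curve_length M \<gamma> =
     (\<integral>\<^sup>+t. indicator {0..1} t * ennreal (tangent_norm M (\<gamma> t) (velocity M \<gamma> t)) \<partial>lborel)"

text \<open>Points in different connected components have distance \<open>\<infinity> = Inf {}\<close>.\<close>

definition rdist :: "('m::topological_space, 'n::finite) riemannian \<Rightarrow> 'm \<Rightarrow> 'm \<Rightarrow> ennreal" where
  "rdist M x y =
     Inf {curve_length M \<gamma> | \<gamma>. piecewise_C1_curve M \<gamma> \<and> \<gamma> 0 = x \<and> \<gamma> 1 = y}"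

definition complete_riemannian :: "('m::topological_space, 'n::finite) riemannian \<Rightarrow> bool" where
  "complete_riemannian M \<longleftrightarrow>
     (\<forall>X :: nat \<Rightarrow> 'm. (\<forall>e>0. \<exists>N. \<forall>i\<ge>N. \<forall>j\<ge>N. rdist M (X i) (X j) < e) \<longrightarrow>
        (\<exists>x. (\<lambda>i. rdist M (X i) x) \<longlonglongrightarrow> 0))"

subsection \<open>Geodesics, exponential map, injectivity radius\<close>

text \<open>\<open>christoffel G x k i j\<close> is the symbol \<open>\<Gamma>\<close> with upper index \<open>k\<close> and lower indices \<open>i, j\<close>.\<close>

definition christoffel ::
  "(real ^ 'n \<Rightarrow> real ^ 'n ^ 'n) \<Rightarrow> real ^ 'n \<Rightarrow> 'n::finite \<Rightarrow> 'n \<Rightarrow> 'n \<Rightarrow> real" where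
  "christoffel G x k i j =
     (let dG = (\<lambda>m. frechet_derivative G (at x) (axis m 1)) in
      (\<Sum>l\<in>UNIV. matrix_inv (G x) $ k $ l * (dG i $ j $ l + dG j $ i $ l - dG l $ i $ j)) / 2)"

definition geodesic ::
  "('m::topological_space, 'n::finite) riemannian \<Rightarrow> (real \<Rightarrow> 'm) \<Rightarrow> bool" where
  "geodesic M \<gamma> \<longleftrightarrow> continuous_on UNIV \<gamma> \<and>
     (\<forall>c\<in>atlas M. \<forall>t. \<gamma> t \<in> fst c \<longrightarrow>
        (let u = snd c \<circ> \<gamma>; u' = (\<lambda>s. vector_derivative u (at s)) in
          u differentiable at t \<and>
          (u' has_vector_derivative
             (\<chi> k. - (\<Sum>i\<in>UNIV. \<Sum>j\<in>UNIV. christoffel (gmat M c) (u t) k i j * u' t $ i * u' t $ j)))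
            (at t)))"

definition rexp ::
  "('m::topological_space, 'n::finite) riemannian \<Rightarrow> 'm \<Rightarrow> real ^ 'n \<Rightarrow> 'm" where
  "rexp M p v = (THE \<gamma>. geodesic M \<gamma> \<and> \<gamma> 0 = p \<and> velocity M \<gamma> 0 = v) 1"

definition diffeo_onto_image ::
  "('m::topological_space, 'n::finite) riemannian \<Rightarrow> (real ^ 'n \<Rightarrow> 'm) \<Rightarrow> (real ^ 'n) set \<Rightarrow> bool" where
  "diffeo_onto_image M E B \<longleftrightarrow>
     open B \<and> open (E ` B) \<and> inj_on E B \<and> continuous_on B E \<and>
     (\<forall>c\<in>atlas M.
        smooth_on {v \<in> B. E v \<in> fst c} (snd c \<circ> E) \<and>
        smooth_on (snd c ` (fst c \<inter> E ` B)) (inv_into B E \<circ> inv_into (fst c) (snd c)))"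

definition injectivity_radius_at ::
  "('m::topological_space, 'n::finite) riemannian \<Rightarrow> 'm \<Rightarrow> ennreal" where
  "injectivity_radius_at M p =
     Sup {ennreal r | r. 0 < r \<and> diffeo_onto_image M (rexp M p) {v. tangent_norm M p v < r}}"

definition injectivity_radius :: "('m::topological_space, 'n::finite) riemannian \<Rightarrow> ennreal" where
  "injectivity_radius M = (INF p. injectivity_radius_at M p)"

subsection \<open>Riemannian measure\<close>

text \<open>
  The Borel measure with density \<open>sqrt (det g)\<close> with respect to Lebesgue measure in every chart.
  These conditions determine it, since countably many chart domains cover the manifold.
\<close>

definition riemannian_measure ::
  "('m::topological_space, 'n::finite) riemannian \<Rightarrow> 'm measure \<Rightarrow> bool" where
  "riemannian_measure M \<mu> \<longleftrightarrow> sets \<mu> = sets borel \<and>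
     (\<forall>c\<in>atlas M. \<forall>B\<in>sets borel. B \<subseteq> fst c \<longrightarrow>
        emeasure \<mu> B = (\<integral>\<^sup>+x. indicator (snd c ` B) x * ennreal (sqrt (det (gmat M c x))) \<partial>lborel))"

section \<open>\<open>L\<^sub>p\<close> norms, exponents \<open>1 \<le> p \<le> \<infinity>\<close> being of type \<open>ennreal\<close>\<close>

definition Lp_norm :: "'a measure \<Rightarrow> ennreal \<Rightarrow> ('a \<Rightarrow> real) \<Rightarrow> ennreal" where
  "Lp_norm \<mu> p f =
     (if p = \<infinity> then esssup \<mu> (\<lambda>x. ennreal \<bar>f x\<bar>)
      else let I = (\<integral>\<^sup>+x. ennreal (\<bar>f x\<bar> powr enn2real p) \<partial>\<mu>) in
        if I = \<infinity> then \<infinity> else ennreal (enn2real I powr (1 / enn2real p)))"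

definition Lp_space :: "'a measure \<Rightarrow> ennreal \<Rightarrow> ('a \<Rightarrow> real) set" where
  "Lp_space \<mu> p = {f \<in> borel_measurable \<mu>. Lp_norm \<mu> p f < \<infinity>}"

definition L2_inner :: "'a measure \<Rightarrow> ('a \<Rightarrow> real) \<Rightarrow> ('a \<Rightarrow> real) \<Rightarrow> real" where
  "L2_inner \<mu> f g = (\<integral>x. f x * g x \<partial>\<mu>)"

definition Lp_dist :: "'a measure \<Rightarrow> ennreal \<Rightarrow> ('a \<Rightarrow> real) \<Rightarrow> ('a \<Rightarrow> real) set \<Rightarrow> ennreal" where
  "Lp_dist \<mu> p f S = (INF s\<in>S. Lp_norm \<mu> p (\<lambda>x. f x - s x))"

definition Lp_opnorm ::
  "'a measure \<Rightarrow> ennreal \<Rightarrow> (('a \<Rightarrow> real) \<Rightarrow> ('a \<Rightarrow> real)) \<Rightarrow> ennreal" where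
  "Lp_opnorm \<mu> p T = (SUP f\<in>{f \<in> Lp_space \<mu> p. Lp_norm \<mu> p f \<le> 1}. Lp_norm \<mu> p (T f))"

text \<open>The discrete norm; \<open>X\<close> is finite and nonempty in all uses.\<close>

definition lp_norm :: "'a set \<Rightarrow> ennreal \<Rightarrow> ('a \<Rightarrow> real) \<Rightarrow> real" where
  "lp_norm X p A =
     (if p = \<infinity> then Max ((\<lambda>x. \<bar>A x\<bar>) ` X)
      else (\<Sum>x\<in>X. \<bar>A x\<bar> powr enn2real p) powr (1 / enn2real p))"

definition powr_quot :: "real \<Rightarrow> real \<Rightarrow> ennreal \<Rightarrow> real" where
  "powr_quot q d p = (if p = \<infinity> then 1 else q powr (d / enn2real p))"

section \<open>Point sets, kernel spaces, and the \<open>L\<^sub>2\<close> projector\<close>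

definition mesh_norm :: "('m::topological_space, 'n::finite) riemannian \<Rightarrow> 'm set \<Rightarrow> ennreal" where
  "mesh_norm M \<Xi> = (SUP x. INF \<xi>\<in>\<Xi>. rdist M x \<xi>)"

text \<open>Equal to \<open>\<infinity>\<close> if \<open>\<Xi>\<close> has at most one point.\<close>

definition separation_radius ::
  "('m::topological_space, 'n::finite) riemannian \<Rightarrow> 'm set \<Rightarrow> ennreal" where
  "separation_radius M \<Xi> = Inf {rdist M \<xi> \<zeta> | \<xi> \<zeta>. \<xi> \<in> \<Xi> \<and> \<zeta> \<in> \<Xi> \<and> \<xi> \<noteq> \<zeta>} / 2"

definition mesh_ratio :: "('m::topological_space, 'n::finite) riemannian \<Rightarrow> 'm set \<Rightarrow> ennreal" where
  "mesh_ratio M \<Xi> = mesh_norm M \<Xi> / separation_radius M \<Xi>"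

definition positive_definite_kernel :: "('m \<Rightarrow> 'm \<Rightarrow> real) \<Rightarrow> bool" where
  "positive_definite_kernel \<kappa> \<longleftrightarrow>
     (\<forall>x y. \<kappa> x y = \<kappa> y x) \<and>
     (\<forall>X a. finite X \<longrightarrow> (\<exists>x\<in>X. a x \<noteq> 0) \<longrightarrow> (\<Sum>x\<in>X. \<Sum>y\<in>X. a x * a y * \<kappa> x y) > 0)"

definition kernel_space :: "('m \<Rightarrow> 'm \<Rightarrow> real) \<Rightarrow> 'm set \<Rightarrow> ('m \<Rightarrow> real) set" where
  "kernel_space \<kappa> \<Xi> = {(\<lambda>x. \<Sum>\<xi>\<in>\<Xi>. a \<xi> * \<kappa> x \<xi>) | a. True}"

definition is_basis :: "'i set \<Rightarrow> ('i \<Rightarrow> 'm \<Rightarrow> real) \<Rightarrow> ('m \<Rightarrow> real) set \<Rightarrow> bool" where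
  "is_basis \<Xi> v S \<longleftrightarrow>
     (\<forall>\<xi>\<in>\<Xi>. v \<xi> \<in> S) \<and>
     (\<forall>s\<in>S. \<exists>A. s = (\<lambda>x. \<Sum>\<xi>\<in>\<Xi>. A \<xi> * v \<xi> x)) \<and>
     (\<forall>A. (\<lambda>x. \<Sum>\<xi>\<in>\<Xi>. A \<xi> * v \<xi> x) = (\<lambda>x. 0) \<longrightarrow> (\<forall>\<xi>\<in>\<Xi>. A \<xi> = 0))"

definition L2_projector ::
  "'m measure \<Rightarrow> ('m \<Rightarrow> 'm \<Rightarrow> real) \<Rightarrow> 'm set \<Rightarrow> ('m \<Rightarrow> real) \<Rightarrow> ('m \<Rightarrow> real)" where
  "L2_projector \<mu> \<kappa> \<Xi> f =
     (THE s. s \<in> kernel_space \<kappa> \<Xi> \<and>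
        (\<forall>g\<in>kernel_space \<kappa> \<Xi>. L2_inner \<mu> s g = L2_inner \<mu> f g))"

end

theory Submission
  imports Defs
begin

text \<open>
  The space \<open>S\<close> spanned by the basis \<open>v\<close> is finite-dimensional, consists of bounded continuous
  functions, and carries a definite \<open>L\<^sub>2\<close> inner product because stability at \<open>p = 2\<close> bounds the
  coefficients by the \<open>L\<^sub>2\<close> norm. Gram-Schmidt yields a finite orthonormal set \<open>E\<close> spanning \<open>S\<close>, and
  the projector becomes the integral operator \<open>T f(x) = \<integral> k x y * f y d\<mu>(y)\<close> whose kernel
  \<open>k x y = (\<Sum>e\<in>E. e x * e y)\<close> is bounded and, decisively, symmetric.
  As the manifold is compact, \<open>\<mu>\<close> is finite, so this formula makes sense on every \<open>L\<^sub>p\<close>.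

  The maximum of the operator norms over \<open>p\<close> is attained at \<open>p = \<infinity>\<close>. Testing \<open>T\<close> on the functions
  \<open>sgn (k x)\<close> shows that the row integrals \<open>\<integral>\<bar>k x y\<bar> d\<mu>(y)\<close> are at most
  \<open>K = \<parallel>T\<parallel>\<close>, the norm on \<open>L\<^sub>\<infinity>\<close>, for almost every \<open>x\<close>; by symmetry the column integrals have the same
  bound, and Schur's test gives \<open>\<parallel>T f\<parallel> \<le> K * \<parallel>f\<parallel>\<close> in \<open>L\<^sub>p\<close> for every \<open>p\<close>
  (lemmas \<open>AE_sum_kernel_le_opnorm\<close> and \<open>Lp_norm_sum_op_le\<close>).

  Quasi-optimality then follows from \<open>f - T f = (f - s) - T (f - s)\<close> for \<open>s \<in> S\<close>
  and Minkowski's inequality.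
\<close>

section \<open>The \<open>L\<^sub>p\<close> norms\<close>

text \<open>
  Both convexity inequalities below, Minkowski's and Jensen's for weights of arbitrary mass, come
  from this tangent line. The endpoint \<open>t = 0\<close>, which lies outside the domain of \<open>powr_convex\<close>, is
  included because the functions they are applied to may vanish.
\<close>

lemma powr_ge_tangent:
  fixes a t r :: real
  assumes "1 \<le> r" "0 < a" "0 \<le> t"
  shows "a powr r + r * a powr (r - 1) * (t - a) \<le> t powr r"
proof (cases "t = 0")
  case True
  have "a powr r = a powr (r - 1) * a"
    using assms by (simp add: powr_diff)
  then have "a powr r + r * a powr (r - 1) * (t - a) = (1 - r) * a powr r"
    using True by (simp add: algebra_simps)
  also have "\<dots> \<le> 0"
    using assms by (simp add: mult_nonpos_nonneg)
  finally show ?thesis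
    using True by simp
next
  case False
  have "r * a powr (r - 1) * (t - a) \<le> t powr r - a powr r"
  proof (rule convex_on_imp_above_tangent[of "{0<..}"])
    show "convex_on {0<..} (\<lambda>x::real. x powr r)"
      using assms by (intro powr_convex)
    show "((\<lambda>x. x powr r) has_real_derivative r * a powr (r - 1)) (at a within {0<..})"
      using assms by (auto intro!: derivative_eq_intros)
  qed (use assms False in \<open>auto simp: interior_open\<close>)
  then show ?thesis by simp
qed

lemma powr_convex_combination_le:
  fixes \<alpha> \<beta> x y r :: real
  assumes "1 \<le> r" "0 \<le> \<alpha>" "0 \<le> \<beta>" "\<alpha> + \<beta> = 1" "0 \<le> x" "0 \<le> y"
  shows "(\<alpha> * x + \<beta> * y) powr r \<le> \<alpha> * x powr r + \<beta> * y powr r"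
proof (cases "\<alpha> * x + \<beta> * y = 0")
  case False
  define a where "a = \<alpha> * x + \<beta> * y"
  have "0 < a"
    using False assms by (simp add: a_def order_less_le)
  define m where "m = r * a powr (r - 1)"
  have "\<alpha> * (a powr r + m * (x - a)) + \<beta> * (a powr r + m * (y - a))
      \<le> \<alpha> * x powr r + \<beta> * y powr r"
    unfolding m_def using assms \<open>0 < a\<close>
    by (intro add_mono mult_left_mono powr_ge_tangent)
  moreover have "\<alpha> * (a powr r + m * (x - a)) + \<beta> * (a powr r + m * (y - a))
      = (\<alpha> + \<beta>) * a powr r + m * (\<alpha> * x + \<beta> * y - (\<alpha> + \<beta>) * a)"
    by (simp add: algebra_simps)
  ultimately show ?thesis
    using assms(4) by (simp add: a_def)
qed (use assms in auto)

lemma enn2real_ge_1: "1 \<le> enn2real p" if "1 \<le> p" "p \<noteq> \<infinity>"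
  using that by (cases p) auto

text \<open>
  All bounds on \<open>Lp_norm\<close> for finite \<open>p\<close> go through this criterion, which hides the root and the
  separate treatment of an infinite integral.
\<close>

lemma Lp_norm_le_iff:
  assumes "1 \<le> p" "p \<noteq> \<infinity>" "0 \<le> c"
  shows "Lp_norm \<mu> p f \<le> ennreal c \<longleftrightarrow>
    (\<integral>\<^sup>+x. ennreal (\<bar>f x\<bar> powr enn2real p) \<partial>\<mu>) \<le> ennreal (c powr enn2real p)"
proof -
  define r where "r = enn2real p"
  have r: "1 \<le> r"
    using assms enn2real_ge_1 by (auto simp: r_def)
  define I where "I = (\<integral>\<^sup>+x. ennreal (\<bar>f x\<bar> powr r) \<partial>\<mu>)"
  show ?thesis
  proof (cases I)
    case (real i)
    have "i powr (1 / r) \<le> c \<longleftrightarrow> i \<le> c powr r"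
    proof
      assume "i powr (1 / r) \<le> c"
      then have "(i powr (1 / r)) powr r \<le> c powr r"
        using r by (intro powr_mono2) auto
      then show "i \<le> c powr r"
        using r real by (simp add: powr_powr)
    next
      assume "i \<le> c powr r"
      then have "i powr (1 / r) \<le> (c powr r) powr (1 / r)"
        using r real by (intro powr_mono2) auto
      then show "i powr (1 / r) \<le> c"
        using r assms by (simp add: powr_powr)
    qed
    then show ?thesis
      using assms real by (simp add: Lp_norm_def I_def[symmetric] r_def[symmetric])
  next
    case top
    then show ?thesis
      using assms by (simp add: Lp_norm_def I_def[symmetric] r_def[symmetric] top_unique)
  qed
qed

lemma Lp_norm_infinity_le_iff:
  assumes "f \<in> borel_measurable \<mu>" "0 \<le> c"
  shows "Lp_norm \<mu> \<infinity> f \<le> ennreal c \<longleftrightarrow> (AE x in \<mu>. \<bar>f x\<bar> \<le> c)"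
proof
  assume "Lp_norm \<mu> \<infinity> f \<le> ennreal c"
  then have "esssup \<mu> (\<lambda>x. ennreal \<bar>f x\<bar>) \<le> ennreal c"
    by (simp add: Lp_norm_def)
  with esssup_AE[where M = \<mu> and f = "\<lambda>x. ennreal \<bar>f x\<bar>"] show "AE x in \<mu>. \<bar>f x\<bar> \<le> c"
    using assms by (auto elim!: eventually_mono dest: order_trans)
next
  assume "AE x in \<mu>. \<bar>f x\<bar> \<le> c"
  then have "esssup \<mu> (\<lambda>x. ennreal \<bar>f x\<bar>) \<le> ennreal c"
    using assms by (intro esssup_I) (auto simp: ennreal_leI)
  then show "Lp_norm \<mu> \<infinity> f \<le> ennreal c"
    by (simp add: Lp_norm_def)
qed

lemma Lp_norm_uminus: "Lp_norm \<mu> p (\<lambda>x. - f x) = Lp_norm \<mu> p f"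
  by (simp add: Lp_norm_def)

text \<open>
  Minkowski's inequality. For positive upper bounds \<open>a\<close>, \<open>b\<close> of the two norms, \<open>(f + g) / (a + b)\<close> is
  a convex combination of the functions \<open>f / a\<close> and \<open>g / b\<close> in the unit ball, so for finite \<open>p\<close>
  convexity of \<open>t powr r\<close> applies pointwise. Positive bounds are available up to an arbitrary
  \<open>e > 0\<close> even if a norm vanishes.
\<close>

lemma Lp_norm_add_le:
  assumes p: "1 \<le> p" and f: "f \<in> borel_measurable \<mu>" and g: "g \<in> borel_measurable \<mu>"
  shows "Lp_norm \<mu> p (\<lambda>x. f x + g x) \<le> Lp_norm \<mu> p f + Lp_norm \<mu> p g"
proof -
  note [measurable] = f g
  have *: "Lp_norm \<mu> p (\<lambda>x. f x + g x) \<le> ennreal (a + b)"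
    if a: "0 < a" "Lp_norm \<mu> p f \<le> ennreal a" and b: "0 < b" "Lp_norm \<mu> p g \<le> ennreal b" for a b
  proof (cases "p = \<infinity>")
    case True
    have "AE x in \<mu>. \<bar>f x\<bar> \<le> a" "AE x in \<mu>. \<bar>g x\<bar> \<le> b"
      using a b True Lp_norm_infinity_le_iff[OF f] Lp_norm_infinity_le_iff[OF g] by auto
    then have "AE x in \<mu>. \<bar>f x + g x\<bar> \<le> a + b"
      by eventually_elim linarith
    then show ?thesis
      using a b True Lp_norm_infinity_le_iff[of "\<lambda>x. f x + g x" \<mu> "a + b"] by simp
  next
    case False
    define r where "r = enn2real p"
    have r: "1 \<le> r"
      using p False enn2real_ge_1 by (auto simp: r_def)
    define s where "s = a + b"
    have s: "0 < s" using a b by (simp add: s_def)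
    \<comment> \<open>Convexity with weights \<open>a / s\<close>, \<open>b / s\<close>, after undoing the scaling by \<open>a\<close>, \<open>b\<close> and \<open>s\<close>.\<close>
    define \<alpha> where "\<alpha> = s powr r * (a / s) / a powr r"
    define \<beta> where "\<beta> = s powr r * (b / s) / b powr r"
    have ab: "a / s + b / s = 1"
      using s by (simp add: s_def flip: add_divide_distrib)
    have nonneg: "0 \<le> \<alpha>" "0 \<le> \<beta>"
      using a b s by (simp_all add: \<alpha>_def \<beta>_def)
    have pointwise: "\<bar>f x + g x\<bar> powr r \<le> \<alpha> * \<bar>f x\<bar> powr r + \<beta> * \<bar>g x\<bar> powr r" for x
    proof -
      have "\<bar>f x + g x\<bar> powr r \<le> (\<bar>f x\<bar> + \<bar>g x\<bar>) powr r"
        using r by (intro powr_mono2) auto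
      also have "\<bar>f x\<bar> + \<bar>g x\<bar> = s * ((a / s) * (\<bar>f x\<bar> / a) + (b / s) * (\<bar>g x\<bar> / b))"
        using a b s by (simp add: field_simps)
      also have "\<dots> powr r = s powr r * ((a / s) * (\<bar>f x\<bar> / a) + (b / s) * (\<bar>g x\<bar> / b)) powr r"
        using a b s by (simp add: powr_mult)
      also have "\<dots> \<le> s powr r * ((a / s) * (\<bar>f x\<bar> / a) powr r + (b / s) * (\<bar>g x\<bar> / b) powr r)"
        using a b s r ab
        by (intro mult_left_mono powr_convex_combination_le) simp_all
      also have "\<dots> = \<alpha> * \<bar>f x\<bar> powr r + \<beta> * \<bar>g x\<bar> powr r"
        using a b s by (simp add: \<alpha>_def \<beta>_def powr_divide algebra_simps)
      finally show ?thesis .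
    qed
    have "(\<integral>\<^sup>+x. ennreal (\<bar>f x + g x\<bar> powr r) \<partial>\<mu>)
        \<le> (\<integral>\<^sup>+x. ennreal \<alpha> * ennreal (\<bar>f x\<bar> powr r) + ennreal \<beta> * ennreal (\<bar>g x\<bar> powr r) \<partial>\<mu>)"
      using nonneg
      by (intro nn_integral_mono)
        (simp add: pointwise flip: ennreal_mult ennreal_plus)
    also have "\<dots> = ennreal \<alpha> * (\<integral>\<^sup>+x. ennreal (\<bar>f x\<bar> powr r) \<partial>\<mu>)
        + ennreal \<beta> * (\<integral>\<^sup>+x. ennreal (\<bar>g x\<bar> powr r) \<partial>\<mu>)"
      by (simp add: nn_integral_add nn_integral_cmult)
    also have "\<dots> \<le> ennreal \<alpha> * ennreal (a powr r) + ennreal \<beta> * ennreal (b powr r)"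
      using a b p False unfolding r_def
      by (intro add_mono mult_left_mono) (simp_all add: Lp_norm_le_iff)
    also have "\<dots> = ennreal (\<alpha> * a powr r + \<beta> * b powr r)"
      using nonneg by (simp flip: ennreal_mult ennreal_plus)
    also have "\<alpha> * a powr r + \<beta> * b powr r = s powr r * (a / s + b / s)"
      using a(1) b(1) unfolding \<alpha>_def \<beta>_def distrib_left by simp
    also have "\<dots> = s powr r"
      by (simp add: ab)
    finally show ?thesis
      using p False s by (simp add: Lp_norm_le_iff r_def flip: s_def)
  qed
  show ?thesis
  proof (rule ennreal_le_epsilon)
    fix e :: real
    assume fin: "Lp_norm \<mu> p f + Lp_norm \<mu> p g < top" and e: "0 < e"
    obtain a where a: "0 \<le> a" "Lp_norm \<mu> p f = ennreal a"
      using fin by (cases "Lp_norm \<mu> p f") auto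
    obtain b where b: "0 \<le> b" "Lp_norm \<mu> p g = ennreal b"
      using fin by (cases "Lp_norm \<mu> p g") auto
    have "Lp_norm \<mu> p (\<lambda>x. f x + g x) \<le> ennreal ((a + e / 2) + (b + e / 2))"
      using a b e by (intro *) auto
    also have "\<dots> = Lp_norm \<mu> p f + Lp_norm \<mu> p g + ennreal e"
      using a b e by (simp flip: ennreal_plus)
    finally show "Lp_norm \<mu> p (\<lambda>x. f x + g x) \<le> Lp_norm \<mu> p f + Lp_norm \<mu> p g + ennreal e" .
  qed
qed

lemma Lp_norm_diff_le:
  assumes "1 \<le> p" "f \<in> borel_measurable \<mu>" "g \<in> borel_measurable \<mu>"
  shows "Lp_norm \<mu> p (\<lambda>x. f x - g x) \<le> Lp_norm \<mu> p f + Lp_norm \<mu> p g"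
  using Lp_norm_add_le[of p f \<mu> "\<lambda>x. - g x"] assms by (simp add: Lp_norm_uminus)

lemma (in finite_measure) Lp_space_integrable_powr:
  assumes "1 \<le> p" "p \<noteq> \<infinity>" "f \<in> Lp_space M p"
  shows "integrable M (\<lambda>x. \<bar>f x\<bar> powr enn2real p)"
proof -
  have [measurable]: "f \<in> borel_measurable M" and fin: "Lp_norm M p f < \<infinity>"
    using assms by (auto simp: Lp_space_def)
  obtain c where "0 \<le> c" "Lp_norm M p f = ennreal c"
    using fin by (cases "Lp_norm M p f") auto
  then have "(\<integral>\<^sup>+x. ennreal (\<bar>f x\<bar> powr enn2real p) \<partial>M) \<le> ennreal (c powr enn2real p)"
    using Lp_norm_le_iff[OF assms(1,2), of c M f] by simp
  then show ?thesis
    by (auto simp: integrable_iff_bounded intro: le_less_trans)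
qed

text \<open>
  Constants are integrable on a finite measure space; they dominate \<open>f\<close> if \<open>p = \<infinity>\<close>, and
  \<open>1 + \<bar>f\<bar> powr r\<close> dominates it if \<open>p\<close> is finite.
\<close>

lemma (in finite_measure) Lp_space_integrable:
  assumes "1 \<le> p" "f \<in> Lp_space M p"
  shows "integrable M f"
proof (cases "p = \<infinity>")
  case True
  have [measurable]: "f \<in> borel_measurable M" and fin: "Lp_norm M p f < \<infinity>"
    using assms by (auto simp: Lp_space_def)
  obtain c where "0 \<le> c" "Lp_norm M p f = ennreal c"
    using fin by (cases "Lp_norm M p f") auto
  then have "AE x in M. \<bar>f x\<bar> \<le> c"
    using True Lp_norm_infinity_le_iff[of f M c] by simp
  then show ?thesis
    by (intro integrable_const_bound[where B = c]) auto
next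
  case False
  have [measurable]: "f \<in> borel_measurable M"
    using assms by (auto simp: Lp_space_def)
  define r where "r = enn2real p"
  have r: "1 \<le> r"
    using assms False enn2real_ge_1 by (auto simp: r_def)
  have "\<bar>t\<bar> \<le> 1 + \<bar>t\<bar> powr r" for t :: real
    using powr_mono[of 1 r "\<bar>t\<bar>"] r by (cases "\<bar>t\<bar> \<le> 1") (auto intro: add_increasing2)
  then show ?thesis
    using Lp_space_integrable_powr[OF assms(1) False assms(2)]
    by (intro Bochner_Integration.integrable_bound[of M "\<lambda>x. 1 + \<bar>f x\<bar> powr r" f])
       (auto simp: r_def)
qed

section \<open>Integral operators with symmetric kernels of finite rank\<close>

text \<open>
  Jensen's inequality for a weight \<open>w\<close> of total mass \<open>W\<close>, homogenized so that \<open>W = 0\<close> is covered: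
  integrate the tangent inequality at the weighted mean \<open>U / W\<close> of \<open>u\<close> against \<open>w\<close>.
\<close>

lemma integral_powr_le:
  fixes w u :: "'a \<Rightarrow> real"
  assumes r: "1 \<le> r" and w: "integrable M w" "\<And>x. 0 \<le> w x" and u: "\<And>x. 0 \<le> u x"
    and wu: "integrable M (\<lambda>x. w x * u x)" and wur: "integrable M (\<lambda>x. w x * u x powr r)"
  shows "(\<integral>x. w x * u x \<partial>M) powr r \<le> (\<integral>x. w x \<partial>M) powr (r - 1) * (\<integral>x. w x * u x powr r \<partial>M)"
proof -
  define W where "W = (\<integral>x. w x \<partial>M)"
  define U where "U = (\<integral>x. w x * u x \<partial>M)"
  have W: "0 \<le> W" and U: "0 \<le> U"
    using w u by (auto simp: W_def U_def intro!: integral_nonneg_AE)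
  show ?thesis
  proof (cases "U = 0")
    case True
    then show ?thesis
      using w u by (auto simp flip: U_def intro!: mult_nonneg_nonneg integral_nonneg_AE)
  next
    case False
    have "W \<noteq> 0"
    proof
      assume "W = 0"
      then have "AE x in M. w x = 0"
        using w integral_nonneg_eq_0_iff_AE[of M w] by (simp add: W_def)
      then have "U = (\<integral>x. 0 \<partial>M)"
        unfolding U_def using wu by (intro integral_cong_AE) auto
      then show False
        using False by simp
    qed
    then have "0 < W" using W by simp
    define a where "a = U / W"
    have "0 < a" using \<open>0 < W\<close> U False by (simp add: a_def)
    define m where "m = r * a powr (r - 1)"
    have "(\<integral>x. a powr r * w x + m * (w x * u x - a * w x) \<partial>M) \<le> (\<integral>x. w x * u x powr r \<partial>M)"
    proof (rule integral_mono)
      fix x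
      have "w x * (a powr r + m * (u x - a)) \<le> w x * u x powr r"
        unfolding m_def using w u r \<open>0 < a\<close> by (intro mult_left_mono powr_ge_tangent) auto
      then show "a powr r * w x + m * (w x * u x - a * w x) \<le> w x * u x powr r"
        by (simp add: algebra_simps)
    qed (use w wu wur in auto)
    also have "(\<integral>x. a powr r * w x + m * (w x * u x - a * w x) \<partial>M) = a powr r * W + m * (U - a * W)"
      using w wu by (simp add: W_def U_def)
    also have "\<dots> = U powr r / W powr r * W"
      using \<open>0 < W\<close> U by (simp add: a_def powr_divide)
    finally have *: "U powr r / W powr r * W \<le> (\<integral>x. w x * u x powr r \<partial>M)" .
    have "U powr r = W powr (r - 1) * (U powr r / W powr r * W)"
      using \<open>0 < W\<close> by (simp add: powr_diff)
    also have "\<dots> \<le> W powr (r - 1) * (\<integral>x. w x * u x powr r \<partial>M)"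
      using * by (intro mult_left_mono) auto
    finally show ?thesis
      by (simp add: U_def W_def)
  qed
qed

text \<open>
  For a finite \<open>L\<^sub>2\<close>-orthonormal \<open>E\<close> this is the orthogonal projection onto its span.
\<close>

definition sum_op :: "'a measure \<Rightarrow> ('a \<Rightarrow> real) set \<Rightarrow> ('a \<Rightarrow> real) \<Rightarrow> ('a \<Rightarrow> real)" where
  "sum_op M E f = (\<lambda>x. \<Sum>e\<in>E. L2_inner M f e * e x)"

definition sum_kernel :: "('a \<Rightarrow> real) set \<Rightarrow> 'a \<Rightarrow> 'a \<Rightarrow> real" where
  "sum_kernel E x y = (\<Sum>e\<in>E. e x * e y)"

lemma sum_kernel_commute: "sum_kernel E x y = sum_kernel E y x"
  by (simp add: sum_kernel_def mult.commute)

locale bounded_functions = finite_measure M for M :: "'a measure" +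
  fixes E :: "('a \<Rightarrow> real) set"
  assumes finite_E: "finite E"
    and measurable_E[measurable (raw)]: "\<And>e. e \<in> E \<Longrightarrow> e \<in> borel_measurable M"
    and bounded_E: "\<And>e. e \<in> E \<Longrightarrow> \<exists>D. \<forall>x. \<bar>e x\<bar> \<le> D"
begin

lemma integrable_mult_E:
  assumes "integrable M f" "e \<in> E"
  shows "integrable M (\<lambda>x. f x * e x)"
proof -
  obtain D where D: "\<And>x. \<bar>e x\<bar> \<le> D"
    using bounded_E assms by blast
  have [measurable]: "f \<in> borel_measurable M" "e \<in> borel_measurable M"
    using assms by auto
  show ?thesis
  proof (rule Bochner_Integration.integrable_bound)
    show "integrable M (\<lambda>x. D * \<bar>f x\<bar>)"
      using assms by simp
    show "AE x in M. norm (f x * e x) \<le> norm (D * \<bar>f x\<bar>)"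
    proof (rule AE_I2)
      fix x
      have "\<bar>e x\<bar> * \<bar>f x\<bar> \<le> \<bar>D\<bar> * \<bar>f x\<bar>"
        using D[of x] by (intro mult_right_mono) auto
      then show "norm (f x * e x) \<le> norm (D * \<bar>f x\<bar>)"
        by (simp add: abs_mult mult.commute)
    qed
  qed measurable
qed

lemma sum_op_measurable: "sum_op M E f \<in> borel_measurable M"
  unfolding sum_op_def by (intro borel_measurable_sum borel_measurable_times) auto

lemma sum_kernel_measurable [measurable]: "sum_kernel E x \<in> borel_measurable M"
  unfolding sum_kernel_def by (intro borel_measurable_sum borel_measurable_times) auto

lemma sum_kernel_measurable_pair [measurable]:
  "(\<lambda>(x, y). sum_kernel E x y) \<in> borel_measurable (M \<Otimes>\<^sub>M M)"
proof -
  have "(\<lambda>z. e (fst z) * e (snd z)) \<in> borel_measurable (M \<Otimes>\<^sub>M M)" if "e \<in> E" for e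
  proof -
    note [measurable] = measurable_E[OF that]
    show ?thesis by measurable
  qed
  then show ?thesis
    unfolding sum_kernel_def split_beta by (intro borel_measurable_sum)
qed

lemma sum_kernel_bounded: obtains D where "0 \<le> D" "\<And>x y. \<bar>sum_kernel E x y\<bar> \<le> D"
proof -
  have "\<exists>D. \<forall>e\<in>E. \<forall>x. \<bar>e x\<bar> \<le> D e"
    using bounded_E by metis
  then obtain D where D: "\<And>e x. e \<in> E \<Longrightarrow> \<bar>e x\<bar> \<le> D e" by blast
  have "\<bar>sum_kernel E x y\<bar> \<le> (\<Sum>e\<in>E. D e * D e)" for x y
    unfolding sum_kernel_def
    by (intro order_trans[OF sum_abs] sum_mono)
      (use D order_trans[OF abs_ge_zero D] in \<open>auto simp: abs_mult intro!: mult_mono\<close>)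
  moreover have "0 \<le> (\<Sum>e\<in>E. D e * D e)"
    by (simp add: sum_nonneg)
  ultimately show thesis using that by blast
qed

lemma integrable_sum_kernel_mult:
  assumes "integrable M f"
  shows "integrable M (\<lambda>y. \<bar>sum_kernel E x y\<bar> * f y)"
proof -
  obtain D where D: "0 \<le> D" "\<And>x y. \<bar>sum_kernel E x y\<bar> \<le> D"
    using sum_kernel_bounded by blast
  have [measurable]: "f \<in> borel_measurable M"
    using assms by auto
  show ?thesis
  proof (rule Bochner_Integration.integrable_bound)
    show "integrable M (\<lambda>x. D * \<bar>f x\<bar>)"
      using assms by simp
    show "AE y in M. norm (\<bar>sum_kernel E x y\<bar> * f y) \<le> norm (D * \<bar>f y\<bar>)"
    proof (rule AE_I2)
      fix y
      show "norm (\<bar>sum_kernel E x y\<bar> * f y) \<le> norm (D * \<bar>f y\<bar>)"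
        using mult_right_mono[OF D(2)[of x y], of "\<bar>f y\<bar>"] D(1) by (simp add: abs_mult)
    qed
  qed measurable
qed

lemma integrable_sum_kernel: "integrable M (\<lambda>y. \<bar>sum_kernel E x y\<bar>)"
  using integrable_sum_kernel_mult[of "\<lambda>_. 1"] by simp

lemma sum_op_eq_integral:
  assumes "integrable M f"
  shows "sum_op M E f x = (\<integral>y. sum_kernel E x y * f y \<partial>M)"
proof -
  have "(\<integral>y. sum_kernel E x y * f y \<partial>M) = (\<integral>y. (\<Sum>e\<in>E. e x * (f y * e y)) \<partial>M)"
    by (simp add: sum_kernel_def sum_distrib_left sum_distrib_right mult_ac)
  also have "\<dots> = sum_op M E f x"
    using integrable_mult_E[OF assms]
    by (subst Bochner_Integration.integral_sum) (auto simp: sum_op_def L2_inner_def mult.commute)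
  finally show ?thesis by simp
qed

lemma abs_sum_op_le:
  assumes "integrable M f"
  shows "\<bar>sum_op M E f x\<bar> \<le> (\<integral>y. \<bar>sum_kernel E x y\<bar> * \<bar>f y\<bar> \<partial>M)"
  using integral_abs_bound[of M "\<lambda>y. sum_kernel E x y * f y"]
  by (simp add: sum_op_eq_integral[OF assms] abs_mult)

text \<open>
  Schur's test. For finite \<open>p\<close>, Jensen with weight \<open>\<bar>k x y\<bar>\<close> uses the row bound once to the power
  \<open>r - 1\<close>; after exchanging the integrals, symmetry of the kernel turns the column integral into a row
  integral, which contributes the remaining factor \<open>B\<close>.
\<close>

lemma Lp_norm_sum_op_le:
  assumes p: "1 \<le> p" and f: "f \<in> Lp_space M p" and B: "0 \<le> B"
    and row: "AE x in M. (\<integral>y. \<bar>sum_kernel E x y\<bar> \<partial>M) \<le> B"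
  shows "Lp_norm M p (sum_op M E f) \<le> ennreal B * Lp_norm M p f"
proof -
  have [measurable]: "f \<in> borel_measurable M" and fin: "Lp_norm M p f < \<infinity>"
    using f by (auto simp: Lp_space_def)
  have f_int: "integrable M f"
    using Lp_space_integrable p f by blast
  note kf_int = integrable_sum_kernel_mult[OF integrable_abs[OF f_int]]
  obtain c where c: "0 \<le> c" "Lp_norm M p f = ennreal c"
    using fin by (cases "Lp_norm M p f") auto
  have "Lp_norm M p (sum_op M E f) \<le> ennreal (B * c)"
  proof (cases "p = \<infinity>")
    case True
    have fc: "AE y in M. \<bar>f y\<bar> \<le> c"
      using True c Lp_norm_infinity_le_iff[of f M c] by simp
    have "\<bar>sum_op M E f x\<bar> \<le> (\<integral>y. \<bar>sum_kernel E x y\<bar> \<partial>M) * c" for x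
    proof -
      have "(\<integral>y. \<bar>sum_kernel E x y\<bar> * \<bar>f y\<bar> \<partial>M) \<le> (\<integral>y. \<bar>sum_kernel E x y\<bar> * c \<partial>M)"
        using fc kf_int integrable_sum_kernel
        by (intro integral_mono_AE) (auto elim!: eventually_mono intro: mult_left_mono)
      then show ?thesis
        using abs_sum_op_le[OF f_int, of x] by simp
    qed
    with row have "AE x in M. \<bar>sum_op M E f x\<bar> \<le> B * c"
      using c by (auto elim!: eventually_mono intro: order_trans mult_right_mono)
    then show ?thesis
      using True B c Lp_norm_infinity_le_iff[OF sum_op_measurable, of "B * c" f] by simp
  next
    case False
    define r where "r = enn2real p"
    have r: "1 \<le> r"
      using p False enn2real_ge_1 by (auto simp: r_def)
    have fr: "integrable M (\<lambda>y. \<bar>f y\<bar> powr r)"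
      using Lp_space_integrable_powr p False f by (auto simp: r_def)
    note kfr_int = integrable_sum_kernel_mult[OF fr]
    have "AE x in M. ennreal (\<bar>sum_op M E f x\<bar> powr r)
        \<le> ennreal (B powr (r - 1)) * (\<integral>\<^sup>+y. ennreal (\<bar>sum_kernel E x y\<bar> * \<bar>f y\<bar> powr r) \<partial>M)"
      using row
    proof eventually_elim
      case (elim x)
      have "\<bar>sum_op M E f x\<bar> powr r \<le> (\<integral>y. \<bar>sum_kernel E x y\<bar> * \<bar>f y\<bar> \<partial>M) powr r"
        using abs_sum_op_le[OF f_int] r by (intro powr_mono2) auto
      also have "\<dots> \<le> (\<integral>y. \<bar>sum_kernel E x y\<bar> \<partial>M) powr (r - 1)
          * (\<integral>y. \<bar>sum_kernel E x y\<bar> * \<bar>f y\<bar> powr r \<partial>M)"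
        using kf_int kfr_int integrable_sum_kernel r by (intro integral_powr_le) auto
      also have "\<dots> \<le> B powr (r - 1) * (\<integral>y. \<bar>sum_kernel E x y\<bar> * \<bar>f y\<bar> powr r \<partial>M)"
        using elim r by (intro mult_right_mono powr_mono2) (auto intro!: integral_nonneg_AE)
      finally have "ennreal (\<bar>sum_op M E f x\<bar> powr r)
          \<le> ennreal (B powr (r - 1) * (\<integral>y. \<bar>sum_kernel E x y\<bar> * \<bar>f y\<bar> powr r \<partial>M))"
        by (rule ennreal_leI)
      also have "\<dots> = ennreal (B powr (r - 1)) * (\<integral>\<^sup>+y. ennreal (\<bar>sum_kernel E x y\<bar> * \<bar>f y\<bar> powr r) \<partial>M)"
        using kfr_int by (subst nn_integral_eq_integral) (auto simp: ennreal_mult')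
      finally show ?case .
    qed
    then have "(\<integral>\<^sup>+x. ennreal (\<bar>sum_op M E f x\<bar> powr r) \<partial>M)
        \<le> (\<integral>\<^sup>+x. ennreal (B powr (r - 1)) * (\<integral>\<^sup>+y. ennreal (\<bar>sum_kernel E x y\<bar> * \<bar>f y\<bar> powr r) \<partial>M) \<partial>M)"
      by (rule nn_integral_mono_AE)
    also have "\<dots> = ennreal (B powr (r - 1)) *
        (\<integral>\<^sup>+x. (\<integral>\<^sup>+y. ennreal (\<bar>sum_kernel E x y\<bar> * \<bar>f y\<bar> powr r) \<partial>M) \<partial>M)"
      by (rule nn_integral_cmult) measurable
    also have "(\<integral>\<^sup>+x. (\<integral>\<^sup>+y. ennreal (\<bar>sum_kernel E x y\<bar> * \<bar>f y\<bar> powr r) \<partial>M) \<partial>M)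
        = (\<integral>\<^sup>+y. (\<integral>\<^sup>+x. ennreal (\<bar>sum_kernel E x y\<bar> * \<bar>f y\<bar> powr r) \<partial>M) \<partial>M)"
    proof -
      interpret pair_sigma_finite M M ..
      show ?thesis by (rule Fubini'[symmetric]) measurable
    qed
    also have "\<dots> = (\<integral>\<^sup>+y. ennreal (\<bar>f y\<bar> powr r) * (\<integral>\<^sup>+x. ennreal \<bar>sum_kernel E y x\<bar> \<partial>M) \<partial>M)"
      by (subst sum_kernel_commute) (simp add: nn_integral_multc ennreal_mult mult.commute[of "ennreal (_ powr _)"])
    also have "\<dots> \<le> (\<integral>\<^sup>+y. ennreal (\<bar>f y\<bar> powr r) * ennreal B \<partial>M)"
    proof (rule nn_integral_mono_AE, use row in eventually_elim)
      case (elim y)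
      have "(\<integral>\<^sup>+x. ennreal \<bar>sum_kernel E y x\<bar> \<partial>M) = ennreal (\<integral>x. \<bar>sum_kernel E y x\<bar> \<partial>M)"
        by (rule nn_integral_eq_integral[OF integrable_sum_kernel]) simp
      then show ?case
        using elim by (intro mult_left_mono) (simp_all add: ennreal_leI)
    qed
    also have "\<dots> = (\<integral>\<^sup>+y. ennreal (\<bar>f y\<bar> powr r) \<partial>M) * ennreal B"
      by (rule nn_integral_multc) measurable
    also have "\<dots> \<le> ennreal (c powr r) * ennreal B"
      using c p False Lp_norm_le_iff[of p c M f] unfolding r_def
      by (intro mult_right_mono) auto
    also have "ennreal (B powr (r - 1)) * (ennreal (c powr r) * ennreal B)
        = ennreal (B powr (r - 1) * (c powr r * B))"
      using B by (simp add: ennreal_mult')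
    also have "B powr (r - 1) * (c powr r * B) = (B * c) powr r"
      using B c by (cases "B = 0") (auto simp: powr_diff powr_mult)
    finally show ?thesis
      using p False B c by (simp add: Lp_norm_le_iff r_def mult_left_mono)
  qed
  then show ?thesis
    using B c by (simp add: ennreal_mult)
qed

end

lemma null_sets_UN_open:
  fixes U :: "'i \<Rightarrow> 'a::second_countable_topology set"
  assumes "\<And>i. open (U i)" "\<And>i. U i \<in> null_sets M"
  shows "(\<Union>i. U i) \<in> null_sets M"
proof -
  obtain F where F: "F \<subseteq> range U" "countable F" "\<Union>F = \<Union>(range U)"
    using Lindelof[of "range U"] assms by blast
  have "A \<in> null_sets M" if "A \<in> F" for A
    using F assms that by blast
  then have "\<Union>F \<in> null_sets M"
    using null_sets_UN'[of F id M] F(2) by simp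
  then show ?thesis using F by simp
qed

locale bounded_continuous_functions = bounded_functions M E
  for M :: "'a::second_countable_topology measure" and E +
  assumes sets_M: "sets M = sets borel"
    and continuous_E: "\<And>e. e \<in> E \<Longrightarrow> continuous_on UNIV e"
begin

lemma sgn_sum_kernel:
  shows "(\<lambda>y. sgn (sum_kernel E x y)) \<in> Lp_space M \<infinity>"
    and "Lp_norm M \<infinity> (\<lambda>y. sgn (sum_kernel E x y)) \<le> 1"
    and "sum_op M E (\<lambda>y. sgn (sum_kernel E x y)) x = (\<integral>y. \<bar>sum_kernel E x y\<bar> \<partial>M)"
proof -
  let ?g = "\<lambda>y. sgn (sum_kernel E x y)"
  have m: "?g \<in> borel_measurable M" by measurable
  have "Lp_norm M \<infinity> ?g \<le> ennreal 1"
    using m by (subst Lp_norm_infinity_le_iff) (auto simp: sgn_real_def)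
  then show 1: "Lp_norm M \<infinity> ?g \<le> 1" by simp
  show 2: "?g \<in> Lp_space M \<infinity>"
    using m le_less_trans[OF 1] by (simp add: Lp_space_def)
  have "integrable M ?g"
    using 2 by (rule Lp_space_integrable[rotated]) simp
  then show "sum_op M E ?g x = (\<integral>y. \<bar>sum_kernel E x y\<bar> \<partial>M)"
    by (simp add: sum_op_eq_integral abs_sgn)
qed

lemma Lp_opnorm_infinity_finite: "Lp_opnorm M \<infinity> (sum_op M E) < \<infinity>"
proof -
  obtain D where D: "0 \<le> D" "\<And>x y. \<bar>sum_kernel E x y\<bar> \<le> D"
    using sum_kernel_bounded by blast
  define B where "B = D * measure M (space M)"
  have "(\<integral>y. \<bar>sum_kernel E x y\<bar> \<partial>M) \<le> B" for x
    using integral_mono[OF integrable_sum_kernel[of x], of "\<lambda>_. D"] D by (simp add: B_def mult.commute)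
  moreover have B: "0 \<le> B" using D by (simp add: B_def)
  ultimately have "Lp_norm M \<infinity> (sum_op M E f) \<le> ennreal B * Lp_norm M \<infinity> f"
    if "f \<in> Lp_space M \<infinity>" for f
    using that by (intro Lp_norm_sum_op_le) auto
  then have "Lp_norm M \<infinity> (sum_op M E f) \<le> ennreal B * 1"
    if "f \<in> Lp_space M \<infinity>" "Lp_norm M \<infinity> f \<le> 1" for f
    using that by (meson order_trans mult_left_mono zero_le)
  then have "Lp_opnorm M \<infinity> (sum_op M E) \<le> ennreal B"
    unfolding Lp_opnorm_def by (intro SUP_least) auto
  then show ?thesis
    by (simp add: le_less_trans)
qed

text \<open>
  The test function \<open>g x = sgn (k x)\<close> makes the value at \<open>x\<close> of the operator equal to the row integral,
  but the operator norm only controls \<open>T (g x)\<close> off a null set \<open>N x\<close> that depends on \<open>x\<close>. Since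
  \<open>T (g x)\<close> is continuous, \<open>N x\<close> is open, and by the Lindelof property the uncountable union of these
  null sets is still null.
\<close>

lemma AE_sum_kernel_le_opnorm:
  assumes B: "0 \<le> B" "Lp_opnorm M \<infinity> (sum_op M E) = ennreal B"
  shows "AE x in M. (\<integral>y. \<bar>sum_kernel E x y\<bar> \<partial>M) \<le> B"
proof -
  define g where "g x y = sgn (sum_kernel E x y)" for x y
  define N where "N x = {z. B < \<bar>sum_op M E (g x) z\<bar>}" for x
  have open_N: "open (N x)" for x
  proof -
    have "continuous_on UNIV (\<lambda>z. \<bar>sum_op M E (g x) z\<bar>)"
      unfolding sum_op_def by (intro continuous_intros continuous_E)
    then show ?thesis
      unfolding N_def by (intro open_Collect_less) (auto intro: continuous_intros)
  qed
  have "N x \<in> null_sets M" for x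
  proof -
    have "Lp_norm M \<infinity> (sum_op M E (g x)) \<le> ennreal B"
      unfolding B(2)[symmetric] Lp_opnorm_def g_def
      by (rule SUP_upper) (simp add: sgn_sum_kernel[unfolded infinity_ennreal_def])
    then have "AE z in M. \<bar>sum_op M E (g x) z\<bar> \<le> B"
      using B Lp_norm_infinity_le_iff[OF sum_op_measurable] by blast
    then have "AE z in M. z \<notin> N x"
      by (auto simp: N_def elim!: eventually_mono)
    then show ?thesis
      using open_N[of x] sets_M by (simp add: AE_iff_null_sets)
  qed
  then have "(\<Union>x. N x) \<in> null_sets M"
    using open_N by (intro null_sets_UN_open)
  then have "AE x in M. x \<notin> (\<Union>x. N x)"
    by (rule AE_not_in)
  then show ?thesis
  proof eventually_elim
    case (elim x)
    then have "\<bar>sum_op M E (g x) x\<bar> \<le> B"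
      by (auto simp: N_def not_less)
    moreover have "sum_op M E (g x) x = (\<integral>y. \<bar>sum_kernel E x y\<bar> \<partial>M)"
      using sgn_sum_kernel(3)[of x] unfolding g_def .
    ultimately show ?case by simp
  qed
qed

theorem Lp_norm_sum_op_le_opnorm_infinity:
  assumes "1 \<le> p" "f \<in> Lp_space M p"
  shows "Lp_norm M p (sum_op M E f) \<le> Lp_opnorm M \<infinity> (sum_op M E) * Lp_norm M p f"
proof -
  obtain B where B: "0 \<le> B" "Lp_opnorm M \<infinity> (sum_op M E) = ennreal B"
    using Lp_opnorm_infinity_finite by (cases "Lp_opnorm M \<infinity> (sum_op M E)") auto
  then show ?thesis
    using assms Lp_norm_sum_op_le[OF assms B(1) AE_sum_kernel_le_opnorm] by simp
qed

end


section \<open>Gram-Schmidt orthonormalization in a space of functions\<close>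

lemma L2_inner_commute: "L2_inner M f g = L2_inner M g f"
  by (simp add: L2_inner_def mult.commute)

lemma L2_inner_scale_left: "L2_inner M (\<lambda>x. c * f x) g = c * L2_inner M f g"
  by (simp add: L2_inner_def mult.assoc)

lemma L2_inner_sum_left:
  assumes "\<And>i. i \<in> I \<Longrightarrow> integrable M (\<lambda>x. h i x * g x)"
  shows "L2_inner M (\<lambda>x. \<Sum>i\<in>I. c i * h i x) g = (\<Sum>i\<in>I. c i * L2_inner M (h i) g)"
proof -
  have "L2_inner M (\<lambda>x. \<Sum>i\<in>I. c i * h i x) g = (\<integral>x. (\<Sum>i\<in>I. c i * (h i x * g x)) \<partial>M)"
    by (simp add: L2_inner_def sum_distrib_right mult.assoc)
  also have "\<dots> = (\<Sum>i\<in>I. c i * L2_inner M (h i) g)"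
    using assms by (subst Bochner_Integration.integral_sum) (auto simp: L2_inner_def)
  finally show ?thesis .
qed

lemma L2_inner_diff_left:
  assumes "integrable M (\<lambda>x. f x * h x)" "integrable M (\<lambda>x. g x * h x)"
  shows "L2_inner M (\<lambda>x. f x - g x) h = L2_inner M f h - L2_inner M g h"
  using assms by (simp add: L2_inner_def left_diff_distrib)

lemma sum_op_diff:
  assumes "\<And>e. e \<in> E \<Longrightarrow> integrable M (\<lambda>x. f x * e x)" "\<And>e. e \<in> E \<Longrightarrow> integrable M (\<lambda>x. g x * e x)"
  shows "sum_op M E (\<lambda>x. f x - g x) = (\<lambda>x. sum_op M E f x - sum_op M E g x)"
  using assms by (simp add: sum_op_def L2_inner_diff_left left_diff_distrib sum_subtractf)

definition L2_orthonormal :: "'a measure \<Rightarrow> ('a \<Rightarrow> real) set \<Rightarrow> bool" where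
  "L2_orthonormal M E \<longleftrightarrow> (\<forall>e\<in>E. \<forall>e'\<in>E. L2_inner M e e' = (if e = e' then 1 else 0))"

locale L2_definite_space =
  fixes M :: "'a measure" and S :: "('a \<Rightarrow> real) set"
  assumes zero_in: "(\<lambda>x. 0) \<in> S"
    and add_in: "\<And>f g. f \<in> S \<Longrightarrow> g \<in> S \<Longrightarrow> (\<lambda>x. f x + g x) \<in> S"
    and scale_in: "\<And>c f. f \<in> S \<Longrightarrow> (\<lambda>x. c * f x) \<in> S"
    and integrable_mult_in: "\<And>f g. f \<in> S \<Longrightarrow> g \<in> S \<Longrightarrow> integrable M (\<lambda>x. f x * g x)"
    and definite: "\<And>f. f \<in> S \<Longrightarrow> L2_inner M f f = 0 \<Longrightarrow> f = (\<lambda>x. 0)"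
begin

lemma diff_in:
  assumes "f \<in> S" "g \<in> S"
  shows "(\<lambda>x. f x - g x) \<in> S"
  using add_in[OF assms(1) scale_in[OF assms(2), of "- 1"]] by simp

lemma sum_in:
  assumes "finite I" "\<And>i. i \<in> I \<Longrightarrow> h i \<in> S"
  shows "(\<lambda>x. \<Sum>i\<in>I. c i * h i x) \<in> S"
  using assms
proof (induction I rule: finite_induct)
  case (insert i I)
  then show ?case
    using add_in[OF scale_in[of "h i" "c i"]] by simp
qed (simp add: zero_in)

lemma sum_op_in:
  assumes "finite E" "E \<subseteq> S"
  shows "sum_op M E f \<in> S"
  unfolding sum_op_def using assms by (intro sum_in) auto

lemma L2_inner_sum_op:
  assumes E: "finite E" "E \<subseteq> S" "L2_orthonormal M E" and e: "e \<in> E"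
  shows "L2_inner M (sum_op M E f) e = L2_inner M f e"
proof -
  have "L2_inner M (sum_op M E f) e = (\<Sum>e'\<in>E. L2_inner M f e' * L2_inner M e' e)"
    unfolding sum_op_def using E e by (intro L2_inner_sum_left integrable_mult_in) auto
  also have "\<dots> = (\<Sum>e'\<in>E. if e' = e then L2_inner M f e else 0)"
    using E e by (intro sum.cong) (auto simp: L2_orthonormal_def)
  finally show ?thesis
    using E e by simp
qed

text \<open>
  Gram-Schmidt, phrased through the operator of \<open>E\<close> instead of spans. The residual \<open>w\<close> of the new
  function is either identically zero or, by definiteness, can be normalized.
\<close>

lemma ex_orthonormal:
  assumes "finite X" "X \<subseteq> S"
  shows "\<exists>E. finite E \<and> E \<subseteq> S \<and> L2_orthonormal M E \<and> (\<forall>f\<in>X. sum_op M E f = f)"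
  using assms
proof (induction X rule: finite_induct)
  case empty
  then show ?case
    by (intro exI[of _ "{}"]) (simp add: L2_orthonormal_def)
next
  case (insert g X)
  then obtain E where E: "finite E" "E \<subseteq> S" "L2_orthonormal M E" and EX: "\<And>f. f \<in> X \<Longrightarrow> sum_op M E f = f"
    by auto
  have g: "g \<in> S" using insert by simp
  define w where "w = (\<lambda>x. g x - sum_op M E g x)"
  have w: "w \<in> S"
    unfolding w_def using g E by (intro diff_in sum_op_in)
  have we: "L2_inner M w e = 0" if "e \<in> E" for e
    unfolding w_def using that E g
    by (subst L2_inner_diff_left) (auto simp: L2_inner_sum_op intro!: integrable_mult_in sum_op_in)
  show ?case
  proof (cases "w = (\<lambda>x. 0)")
    case True
    then have "sum_op M E g = g"
      by (simp add: w_def fun_eq_iff)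
    then show ?thesis
      using E EX by blast
  next
    case False
    define n where "n = sqrt (L2_inner M w w)"
    have "0 < L2_inner M w w"
      using False definite[OF w] integral_nonneg_AE[of "\<lambda>x. w x * w x" M]
      by (auto simp: L2_inner_def order_less_le)
    then have n: "0 < n" "L2_inner M w w = n * n"
      by (auto simp: n_def)
    define e0 where "e0 = (\<lambda>x. (1 / n) * w x)"
    have e0: "e0 \<in> S"
      unfolding e0_def using w by (rule scale_in)
    have e0_inner: "L2_inner M e0 h = L2_inner M w h / n" for h
      unfolding e0_def by (subst L2_inner_scale_left) simp
    have e0e: "L2_inner M e0 e = 0" if "e \<in> E" for e
      using that by (simp add: e0_inner we)
    have ee0: "L2_inner M e e0 = 0" if "e \<in> E" for e
      using e0e[OF that] by (subst L2_inner_commute)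
    have e0e0: "L2_inner M e0 e0 = 1"
      using n by (simp add: e0_inner L2_inner_commute[of M w e0])
    have "e0 \<notin> E"
      using e0e e0e0 by force
    have ortho: "L2_orthonormal M (insert e0 E)"
      using E(3) e0e ee0 e0e0 \<open>e0 \<notin> E\<close> by (auto simp: L2_orthonormal_def)
    have sum_op_e0: "L2_inner M (sum_op M E f) e0 = 0" for f
      unfolding sum_op_def using E e0
      by (subst L2_inner_sum_left)
        (auto intro!: integrable_mult_in simp: ee0)
    have insert_op: "sum_op M (insert e0 E) f x = L2_inner M f e0 * e0 x + sum_op M E f x" for f x
      using E(1) \<open>e0 \<notin> E\<close> by (simp add: sum_op_def)
    have "sum_op M (insert e0 E) f = f" if "f \<in> X" for f
      using sum_op_e0[of f] EX[OF that] by (simp add: fun_eq_iff insert_op)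
    moreover have "sum_op M (insert e0 E) g = g"
    proof -
      have "L2_inner M w e0 = L2_inner M g e0 - L2_inner M (sum_op M E g) e0"
        unfolding w_def using g e0 E by (intro L2_inner_diff_left integrable_mult_in sum_op_in)
      then have "L2_inner M g e0 = n"
        using n by (simp add: sum_op_e0 e0_inner L2_inner_commute[of M w e0])
      then have "L2_inner M g e0 * e0 x = w x" for x
        using n by (simp add: e0_def)
      then show ?thesis
        by (simp add: fun_eq_iff insert_op w_def)
    qed
    ultimately show ?thesis
      using E e0 ortho by (intro exI[of _ "insert e0 E"]) auto
  qed
qed

lemma ex_reproducing:
  assumes I: "finite I" "\<And>i. i \<in> I \<Longrightarrow> v i \<in> S"
    and span: "\<And>s. s \<in> S \<Longrightarrow> \<exists>A. s = (\<lambda>x. \<Sum>i\<in>I. A i * v i x)"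
  shows "\<exists>E. finite E \<and> E \<subseteq> S \<and> (\<forall>s\<in>S. sum_op M E s = s)"
proof -
  obtain E where E: "finite E" "E \<subseteq> S" and Ev: "\<And>i. i \<in> I \<Longrightarrow> sum_op M E (v i) = v i"
    using ex_orthonormal[of "v ` I"] I by (auto simp: image_subset_iff)
  have "sum_op M E s = s" if s: "s \<in> S" for s
  proof
    fix x
    obtain A where A: "s = (\<lambda>x. \<Sum>i\<in>I. A i * v i x)"
      using span[OF s] by blast
    have "sum_op M E s x = (\<Sum>e\<in>E. (\<Sum>i\<in>I. A i * L2_inner M (v i) e) * e x)"
      unfolding sum_op_def A using E I
      by (intro sum.cong refl arg_cong2[where f = "(*)"] L2_inner_sum_left integrable_mult_in) auto
    also have "\<dots> = (\<Sum>i\<in>I. A i * sum_op M E (v i) x)"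
      unfolding sum_op_def sum_distrib_left sum_distrib_right
      by (subst sum.swap) (simp add: mult.assoc)
    also have "\<dots> = s x"
      using Ev by (simp add: A)
    finally show "sum_op M E s x = s x" .
  qed
  then show ?thesis
    using E by blast
qed

text \<open>
  If \<open>sum_op M E\<close> reproduces \<open>S\<close>, then for \<open>g\<close> in \<open>S\<close> the symmetry of the operator gives
  \<open>\<langle>T f, g\<rangle> = \<langle>f, T g\<rangle> = \<langle>f, g\<rangle>\<close>. If \<open>E\<close> consists of bounded functions, every
  integrable \<open>f\<close> satisfies the last assumption, so the projector is identified on all of \<open>L\<^sub>1\<close>.
\<close>

lemma L2_projection_unique:
  assumes E: "finite E" "E \<subseteq> S" "\<And>s. s \<in> S \<Longrightarrow> sum_op M E s = s"
    and f: "\<And>e. e \<in> E \<Longrightarrow> integrable M (\<lambda>x. f x * e x)"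
  shows "(THE s. s \<in> S \<and> (\<forall>g\<in>S. L2_inner M s g = L2_inner M f g)) = sum_op M E f"
proof (rule the_equality)
  have "L2_inner M (sum_op M E f) g = L2_inner M f g" if g: "g \<in> S" for g
  proof -
    have "L2_inner M (sum_op M E f) g = (\<Sum>e\<in>E. L2_inner M f e * L2_inner M e g)"
      unfolding sum_op_def using E g by (intro L2_inner_sum_left integrable_mult_in) auto
    also have "\<dots> = (\<Sum>e\<in>E. L2_inner M g e * L2_inner M e f)"
      by (simp add: L2_inner_commute[of M _ f] L2_inner_commute[of M g] mult.commute)
    also have "\<dots> = L2_inner M (sum_op M E g) f"
      unfolding sum_op_def using f by (intro L2_inner_sum_left[symmetric]) (auto simp: mult.commute)
    finally show ?thesis
      using E(3)[OF g] by (simp add: L2_inner_commute)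
  qed
  then show *: "sum_op M E f \<in> S \<and> (\<forall>g\<in>S. L2_inner M (sum_op M E f) g = L2_inner M f g)"
    using sum_op_in E by blast
  fix s assume s: "s \<in> S \<and> (\<forall>g\<in>S. L2_inner M s g = L2_inner M f g)"
  define d where "d = (\<lambda>x. s x - sum_op M E f x)"
  have d: "d \<in> S"
    unfolding d_def using s * by (intro diff_in) auto
  have "L2_inner M d d = L2_inner M s d - L2_inner M (sum_op M E f) d"
    unfolding d_def using s * d[unfolded d_def] by (intro L2_inner_diff_left integrable_mult_in) auto
  then have "L2_inner M d d = 0"
    using s * d by simp
  then have "d = (\<lambda>x. 0)"
    using d definite by blast
  then show "s = sum_op M E f"
    by (simp add: d_def fun_eq_iff)
qed

end

section \<open>Quasi-optimality of bounded projections\<close>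

lemma Lp_norm_diff_projection_le:
  fixes K :: ennreal
  assumes p: "1 \<le> p" and K: "K < \<infinity>" and f: "f \<in> Lp_space M p"
    and S: "S \<noteq> {}" "S \<subseteq> Lp_space M p"
    and T_diff: "\<And>s. s \<in> S \<Longrightarrow> T (\<lambda>x. f x - s x) = (\<lambda>x. T f x - s x)"
    and T_measurable: "\<And>g. g \<in> Lp_space M p \<Longrightarrow> T g \<in> borel_measurable M"
    and T_bounded: "\<And>g. g \<in> Lp_space M p \<Longrightarrow> Lp_norm M p (T g) \<le> K * Lp_norm M p g"
  shows "Lp_norm M p (\<lambda>x. f x - T f x) \<le> (1 + K) * Lp_dist M p f S"
proof -
  have *: "Lp_norm M p (\<lambda>x. f x - T f x) \<le> (1 + K) * Lp_norm M p (\<lambda>x. f x - s x)" if s: "s \<in> S" for s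
  proof -
    let ?g = "\<lambda>x. f x - s x"
    have sf: "s \<in> Lp_space M p" using s S by blast
    have g_meas: "?g \<in> borel_measurable M"
      using f sf by (auto simp: Lp_space_def)
    have "Lp_norm M p ?g \<le> Lp_norm M p f + Lp_norm M p s"
      using f sf p by (intro Lp_norm_diff_le) (auto simp: Lp_space_def)
    also have "\<dots> < \<infinity>"
      using f sf by (simp add: Lp_space_def)
    finally have g: "?g \<in> Lp_space M p"
      using g_meas by (simp add: Lp_space_def)
    have "(\<lambda>x. f x - T f x) = (\<lambda>x. ?g x - T ?g x)"
      using T_diff[OF s] by simp
    then have "Lp_norm M p (\<lambda>x. f x - T f x) \<le> Lp_norm M p ?g + Lp_norm M p (T ?g)"
      using Lp_norm_diff_le[OF p g_meas T_measurable[OF g]] by simp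
    also have "\<dots> \<le> Lp_norm M p ?g + K * Lp_norm M p ?g"
      using T_bounded[OF g] by (intro add_left_mono)
    finally show ?thesis
      by (simp add: distrib_right)
  qed
  have c: "1 + K \<noteq> 0" "1 + K \<noteq> \<infinity>"
    using K by auto
  have "Lp_norm M p (\<lambda>x. f x - T f x) / (1 + K) \<le> Lp_dist M p f S"
    unfolding Lp_dist_def
  proof (rule INF_greatest)
    fix s assume "s \<in> S"
    from *[OF this] show "Lp_norm M p (\<lambda>x. f x - T f x) / (1 + K) \<le> Lp_norm M p (\<lambda>x. f x - s x)"
      using c by (intro divide_le_posI_ennreal) (auto simp: mult.commute zero_less_iff_neq_zero)
  qed
  then have "Lp_norm M p (\<lambda>x. f x - T f x) / (1 + K) * (1 + K) \<le> Lp_dist M p f S * (1 + K)"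
    by (rule mult_right_mono) simp
  also have "Lp_norm M p (\<lambda>x. f x - T f x) / (1 + K) * (1 + K) = Lp_norm M p (\<lambda>x. f x - T f x)"
    using c divide_eq_1_ennreal[of "1 + K" "1 + K"] by (simp add: ennreal_divide_times)
  finally show ?thesis
    by (simp add: mult.commute)
qed

section \<open>Finiteness of the Riemannian measure\<close>

lemma continuous_on_det:
  fixes G :: "'a::topological_space \<Rightarrow> real ^ 'n ^ 'n"
  assumes "continuous_on S G"
  shows "continuous_on S (\<lambda>x. det (G x))"
  unfolding det_def using assms by (intro continuous_intros)

text \<open>
  Around each point, the preimage of a ball whose closure lies in the image of a chart has finite
  measure, because the continuous density \<open>sqrt (det g)\<close> is bounded on the closed ball; finitely many
  such preimages cover the manifold.
\<close>

lemma finite_riemannian_measure: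
  fixes M :: "('m::{t2_space, second_countable_topology}, 'n::finite) riemannian"
  assumes M: "riemannian_manifold M" and compact: "compact (UNIV :: 'm set)"
    and \<mu>: "riemannian_measure M \<mu>"
  shows "finite_measure \<mu>"
proof -
  have sets: "sets \<mu> = sets borel"
    using \<mu> by (simp add: riemannian_measure_def)
  have "\<exists>V. open V \<and> p \<in> V \<and> emeasure \<mu> V < \<infinity>" for p
  proof -
    have "p \<in> (\<Union>c\<in>atlas M. fst c)"
      using M by (simp add: riemannian_manifold_def)
    then obtain c where c: "c \<in> atlas M" "p \<in> fst c" by blast
    define U \<phi> where "U = fst c" and "\<phi> = snd c"
    have "is_chart c"
      using M c by (simp add: riemannian_manifold_def)
    then have U: "open U" "open (\<phi> ` U)" "continuous_on U \<phi>"
      by (auto simp: is_chart_def U_def \<phi>_def homeomorphism_def split: prod.splits)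
    have "\<phi> p \<in> \<phi> ` U"
      using c by (simp add: U_def)
    then obtain r where r: "0 < r" "cball (\<phi> p) r \<subseteq> \<phi> ` U"
      using U(2) open_contains_cball by blast
    have "smooth_on (\<phi> ` U) (gmat M c)"
      using M c by (simp add: riemannian_manifold_def U_def \<phi>_def)
    then have "Ck_on 0 (\<phi> ` U) (gmat M c)"
      unfolding smooth_on_def by blast
    then have "continuous_on (cball (\<phi> p) r) (gmat M c)"
      using r by (auto intro: continuous_on_subset)
    then have "continuous_on (cball (\<phi> p) r) (\<lambda>x. sqrt (det (gmat M c x)))"
      by (intro continuous_on_real_sqrt continuous_on_det)
    then have "bounded ((\<lambda>x. sqrt (det (gmat M c x))) ` cball (\<phi> p) r)"
      by (intro compact_imp_bounded compact_continuous_image) auto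
    then obtain D where D: "\<And>x. x \<in> cball (\<phi> p) r \<Longrightarrow> \<bar>sqrt (det (gmat M c x))\<bar> \<le> D"
      unfolding bounded_iff by (metis imageI real_norm_def)
    define V where "V = \<phi> -` ball (\<phi> p) r \<inter> U"
    have V: "open V" "p \<in> V" "V \<subseteq> U"
      using U r c continuous_on_open_vimage[of U \<phi>] by (auto simp: V_def U_def)
    have "emeasure \<mu> V = (\<integral>\<^sup>+x. indicator (\<phi> ` V) x * ennreal (sqrt (det (gmat M c x))) \<partial>lborel)"
      using \<mu> c V by (simp add: riemannian_measure_def U_def \<phi>_def)
    also have "\<dots> \<le> (\<integral>\<^sup>+x. ennreal D * indicator (cball (\<phi> p) r) x \<partial>lborel)"
    proof (rule nn_integral_mono)
      fix x
      show "indicator (\<phi> ` V) x * ennreal (sqrt (det (gmat M c x)))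
          \<le> ennreal D * indicator (cball (\<phi> p) r) x"
        using D[of x] by (auto simp: V_def indicator_def intro!: ennreal_leI)
    qed
    also have "\<dots> = ennreal D * emeasure lborel (cball (\<phi> p) r)"
      by (rule nn_integral_cmult_indicator) simp
    also have "\<dots> < \<infinity>"
      using emeasure_bounded_finite[of "cball (\<phi> p) r"] by (simp add: ennreal_mult_less_top)
    finally show ?thesis
      using V by blast
  qed
  then obtain V where V: "\<And>p. open (V p)" "\<And>p. p \<in> V p" "\<And>p. emeasure \<mu> (V p) < \<infinity>"
    by metis
  obtain P where P: "finite P" "UNIV \<subseteq> (\<Union>p\<in>P. V p)"
    using compactE_image[OF compact, of UNIV V] V by (metis UNIV_I UN_I subsetI)
  have "emeasure \<mu> (space \<mu>) \<le> emeasure \<mu> (\<Union>p\<in>P. V p)"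
    using P V sets by (intro emeasure_mono) auto
  also have "\<dots> \<le> (\<Sum>p\<in>P. emeasure \<mu> (V p))"
    using P V sets by (intro emeasure_subadditive_finite) auto
  also have "\<dots> < \<infinity>"
    using P V by simp
  finally show ?thesis
    by (intro finite_measureI) simp
qed

section \<open>Kernel spaces with a stable, bounded basis\<close>

lemma kernel_spaceI:
  assumes "\<And>x. f x = (\<Sum>\<xi>\<in>X. a \<xi> * \<kappa> x \<xi>)"
  shows "f \<in> kernel_space \<kappa> X"
  using assms by (auto simp: kernel_space_def fun_eq_iff)

lemma kernel_space_add:
  assumes "f \<in> kernel_space \<kappa> X" "g \<in> kernel_space \<kappa> X"
  shows "(\<lambda>x. f x + g x) \<in> kernel_space \<kappa> X"
proof -
  obtain a b where "f = (\<lambda>x. \<Sum>\<xi>\<in>X. a \<xi> * \<kappa> x \<xi>)" "g = (\<lambda>x. \<Sum>\<xi>\<in>X. b \<xi> * \<kappa> x \<xi>)"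
    using assms by (auto simp: kernel_space_def)
  then show ?thesis
    by (intro kernel_spaceI[where a = "\<lambda>\<xi>. a \<xi> + b \<xi>"]) (simp add: sum.distrib distrib_right)
qed

lemma kernel_space_scale:
  assumes "f \<in> kernel_space \<kappa> X"
  shows "(\<lambda>x. c * f x) \<in> kernel_space \<kappa> X"
proof -
  obtain a where "f = (\<lambda>x. \<Sum>\<xi>\<in>X. a \<xi> * \<kappa> x \<xi>)"
    using assms by (auto simp: kernel_space_def)
  then show ?thesis
    by (intro kernel_spaceI[where a = "\<lambda>\<xi>. c * a \<xi>"]) (simp add: sum_distrib_left mult.assoc)
qed

lemma kernel_space_zero: "(\<lambda>x. 0) \<in> kernel_space \<kappa> X"
  by (intro kernel_spaceI[where a = "\<lambda>_. 0"]) simp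

lemma lp_norm_2_eq_0:
  assumes "finite X" "lp_norm X 2 A \<le> 0" "\<xi> \<in> X"
  shows "A \<xi> = 0"
proof -
  have "(\<Sum>x\<in>X. \<bar>A x\<bar> powr 2) powr (1 / 2) \<le> 0"
    using assms by (simp add: lp_norm_def)
  then have "(\<Sum>x\<in>X. \<bar>A x\<bar> powr 2) = 0"
    using powr_ge_zero[of "\<Sum>x\<in>X. \<bar>A x\<bar> powr 2" "1 / 2"] by (simp add: powr_eq_0_iff)
  then show ?thesis
    using assms by (simp add: sum_nonneg_eq_0_iff)
qed

theorem corollary5p2:
  fixes M :: "('m::{t2_space, second_countable_topology}, 'n::finite) riemannian"
    and \<mu> :: "'m measure"
    and \<kappa> :: "'m \<Rightarrow> 'm \<Rightarrow> real"
    and \<rho> C\<^sub>1 \<nu> c\<^sub>1 c\<^sub>2 q :: real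
    and \<Xi> :: "'m set"
    and v :: "'m \<Rightarrow> 'm \<Rightarrow> real"
  assumes manifold: "riemannian_manifold M" "compact (UNIV :: 'm set)" "complete_riemannian M"
    and measure: "riemannian_measure M \<mu>"
    and kernel: "positive_definite_kernel \<kappa>"
    and constants: "0 < \<rho>" "0 < C\<^sub>1" "0 < \<nu>" "0 < c\<^sub>1" "c\<^sub>1 < c\<^sub>2"
    and points: "finite \<Xi>" "0 < q" "separation_radius M \<Xi> = ennreal q" "mesh_ratio M \<Xi> = ennreal \<rho>"
    and basis: "is_basis \<Xi> v (kernel_space \<kappa> \<Xi>)" "\<And>\<xi>. \<xi> \<in> \<Xi> \<Longrightarrow> continuous_on UNIV (v \<xi>)"
    and stability: "\<And>(p::ennreal) (A :: 'm \<Rightarrow> real). 1 \<le> p \<Longrightarrow>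
          ennreal (c\<^sub>1 * powr_quot q (real CARD('n)) p * lp_norm \<Xi> p A)
            \<le> Lp_norm \<mu> p (\<lambda>x. \<Sum>\<xi>\<in>\<Xi>. A \<xi> * v \<xi> x) \<and>
          Lp_norm \<mu> p (\<lambda>x. \<Sum>\<xi>\<in>\<Xi>. A \<xi> * v \<xi> x)
            \<le> ennreal (c\<^sub>2 * powr_quot q (real CARD('n)) p * lp_norm \<Xi> p A)"
    and localization: "\<And>\<xi> x. \<xi> \<in> \<Xi> \<Longrightarrow>
          \<bar>v \<xi> x\<bar> \<le> C\<^sub>1 * exp (- \<nu> * (enn2real (min (rdist M x \<xi>) (injectivity_radius M)) / q))"
  shows "\<exists>p\<^sub>0 \<ge> 1.
           (\<forall>p\<ge>1. Lp_opnorm \<mu> p (L2_projector \<mu> \<kappa> \<Xi>) \<le> Lp_opnorm \<mu> p\<^sub>0 (L2_projector \<mu> \<kappa> \<Xi>)) \<and>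
           Lp_opnorm \<mu> p\<^sub>0 (L2_projector \<mu> \<kappa> \<Xi>) < \<infinity> \<and>
           (\<exists>K \<le> Lp_opnorm \<mu> p\<^sub>0 (L2_projector \<mu> \<kappa> \<Xi>).
              \<forall>p\<ge>1. \<forall>f\<in>Lp_space \<mu> p.
                Lp_norm \<mu> p (\<lambda>x. f x - L2_projector \<mu> \<kappa> \<Xi> f x)
                  \<le> (1 + K) * Lp_dist \<mu> p f (kernel_space \<kappa> \<Xi>))"
proof -
  let ?S = "kernel_space \<kappa> \<Xi>" and ?T = "L2_projector \<mu> \<kappa> \<Xi>"
  have sets_\<mu>: "sets \<mu> = sets borel"
    using measure by (simp add: riemannian_measure_def)
  interpret finite_measure \<mu>
    using finite_riemannian_measure manifold measure by blast
  have expand: "\<exists>A. s = (\<lambda>x. \<Sum>\<xi>\<in>\<Xi>. A \<xi> * v \<xi> x)" if "s \<in> ?S" for s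
    using basis(1) that by (simp add: is_basis_def)
  \<comment> \<open>The exponent in the localization estimate is never positive.\<close>
  have v_bounded: "\<bar>v \<xi> x\<bar> \<le> C\<^sub>1" if "\<xi> \<in> \<Xi>" for \<xi> x
  proof -
    have "exp (- \<nu> * (enn2real (min (rdist M x \<xi>) (injectivity_radius M)) / q)) \<le> 1"
      using constants points by (simp add: mult_nonneg_nonneg)
    then show ?thesis
      using localization[OF that, of x] constants
      by (smt (verit) mult_left_le)
  qed
  have S_continuous: "continuous_on UNIV s" and S_bounded: "\<exists>D. \<forall>x. \<bar>s x\<bar> \<le> D" if s: "s \<in> ?S" for s
  proof -
    obtain A where A: "s = (\<lambda>x. \<Sum>\<xi>\<in>\<Xi>. A \<xi> * v \<xi> x)"
      using expand[OF s] by blast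
    show "continuous_on UNIV s"
      unfolding A by (intro continuous_intros basis)
    have "\<bar>s x\<bar> \<le> (\<Sum>\<xi>\<in>\<Xi>. \<bar>A \<xi>\<bar> * C\<^sub>1)" for x
      unfolding A by (intro order_trans[OF sum_abs] sum_mono) (simp add: abs_mult mult_left_mono v_bounded)
    then show "\<exists>D. \<forall>x. \<bar>s x\<bar> \<le> D" by blast
  qed
  have S_measurable: "s \<in> borel_measurable \<mu>" if "s \<in> ?S" for s
    using borel_measurable_continuous_onI[OF S_continuous[OF that]] sets_\<mu>
    by (simp cong: measurable_cong_sets)
  have S_Lp: "s \<in> Lp_space \<mu> p" if p: "1 \<le> p" and s: "s \<in> ?S" for p s
  proof -
    obtain A where A: "s = (\<lambda>x. \<Sum>\<xi>\<in>\<Xi>. A \<xi> * v \<xi> x)"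
      using expand[OF s] by blast
    have "Lp_norm \<mu> p s < \<infinity>"
      unfolding A using stability[OF p, of A] by (auto intro: le_less_trans)
    then show ?thesis
      using S_measurable[OF s] by (simp add: Lp_space_def)
  qed
  \<comment> \<open>A function of \<open>L\<^sub>2\<close> norm zero in the space has all coefficients zero by the lower stability bound for \<open>p = 2\<close>.\<close>
  have S_definite: "s = (\<lambda>x. 0)" if s: "s \<in> ?S" "L2_inner \<mu> s s = 0" for s
  proof -
    obtain A where A: "s = (\<lambda>x. \<Sum>\<xi>\<in>\<Xi>. A \<xi> * v \<xi> x)"
      using expand[OF s(1)] by blast
    have int: "integrable \<mu> (\<lambda>x. s x * s x)"
      using Lp_space_integrable_powr[OF _ _ S_Lp[OF _ s(1)], of 2] by (simp add: power2_eq_square)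
    have "AE x in \<mu>. s x * s x = 0"
      using s(2) integral_nonneg_eq_0_iff_AE[OF int] by (simp add: L2_inner_def)
    then have "(\<integral>\<^sup>+x. ennreal (\<bar>s x\<bar> powr enn2real 2) \<partial>\<mu>) = (\<integral>\<^sup>+x. 0 \<partial>\<mu>)"
      by (intro nn_integral_cong_AE) (auto elim!: eventually_mono)
    then have "Lp_norm \<mu> 2 s \<le> ennreal 0"
      by (subst Lp_norm_le_iff) auto
    then have "ennreal (c\<^sub>1 * powr_quot q (real CARD('n)) 2 * lp_norm \<Xi> 2 A) \<le> 0"
      using stability[of 2 A] by (simp flip: A)
    moreover have "0 < c\<^sub>1 * powr_quot q (real CARD('n)) 2"
      using constants points by (simp add: powr_quot_def)
    ultimately have "lp_norm \<Xi> 2 A \<le> 0"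
      by (auto simp: ennreal_eq_0_iff mult_le_0_iff zero_less_mult_iff)
    then show ?thesis
      using lp_norm_2_eq_0[OF points(1), of A] by (simp add: A)
  qed
  have S_integrable_mult: "integrable \<mu> (\<lambda>x. f x * s x)" if "integrable \<mu> f" "s \<in> ?S" for f s
  proof -
    interpret bounded_functions \<mu> "{s}"
      by unfold_locales (use that S_bounded S_measurable in auto)
    show ?thesis
      using that by (intro integrable_mult_E) auto
  qed
  interpret L2_definite_space \<mu> ?S
  proof
    show "integrable \<mu> (\<lambda>x. f x * g x)" if "f \<in> ?S" "g \<in> ?S" for f g
      using that Lp_space_integrable[OF order_refl S_Lp[OF order_refl that(1)]]
      by (intro S_integrable_mult)
  qed (use S_definite in \<open>auto intro: kernel_space_add kernel_space_scale kernel_space_zero\<close>)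
  have "\<And>\<xi>. \<xi> \<in> \<Xi> \<Longrightarrow> v \<xi> \<in> ?S"
    using basis(1) by (simp add: is_basis_def)
  then obtain E where E: "finite E" "E \<subseteq> ?S" "\<And>s. s \<in> ?S \<Longrightarrow> sum_op \<mu> E s = s"
    using ex_reproducing[OF points(1) _ expand] by blast
  interpret bounded_continuous_functions \<mu> E
    by unfold_locales (use E S_measurable S_bounded S_continuous sets_\<mu> in auto)
  have T_eq: "?T f = sum_op \<mu> E f" if "1 \<le> p" "f \<in> Lp_space \<mu> p" for p f
    unfolding L2_projector_def
    using E S_integrable_mult Lp_space_integrable[OF that] by (intro L2_projection_unique) auto
  have opnorm_eq: "Lp_opnorm \<mu> p ?T = Lp_opnorm \<mu> p (sum_op \<mu> E)" if "1 \<le> p" for p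
    unfolding Lp_opnorm_def using T_eq[OF that] by (intro SUP_cong) auto
  define K where "K = Lp_opnorm \<mu> \<infinity> ?T"
  have K_eq: "K = Lp_opnorm \<mu> \<infinity> (sum_op \<mu> E)"
    unfolding K_def by (rule opnorm_eq) simp
  have K_finite: "K < \<infinity>"
    unfolding K_eq by (rule Lp_opnorm_infinity_finite)
  have T_le: "Lp_norm \<mu> p (?T f) \<le> K * Lp_norm \<mu> p f" if "1 \<le> p" "f \<in> Lp_space \<mu> p" for p f
    using Lp_norm_sum_op_le_opnorm_infinity[OF that] T_eq[OF that] by (simp add: K_eq)
  have max: "Lp_opnorm \<mu> p ?T \<le> K" if "1 \<le> p" for p
    unfolding Lp_opnorm_def
  proof (rule SUP_least)
    fix f assume "f \<in> {f \<in> Lp_space \<mu> p. Lp_norm \<mu> p f \<le> 1}"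
    then have "Lp_norm \<mu> p (?T f) \<le> K * Lp_norm \<mu> p f" "K * Lp_norm \<mu> p f \<le> K * 1"
      using T_le[OF that] by (blast, intro mult_left_mono) simp_all
    then show "Lp_norm \<mu> p (?T f) \<le> K" by simp
  qed
  have quasi_optimal: "Lp_norm \<mu> p (\<lambda>x. f x - ?T f x) \<le> (1 + K) * Lp_dist \<mu> p f ?S"
    if "1 \<le> p" "f \<in> Lp_space \<mu> p" for p f
  proof (rule Lp_norm_diff_projection_le[OF that(1) K_finite that(2)])
    show "?S \<noteq> {}" using zero_in by blast
    show "?S \<subseteq> Lp_space \<mu> p" using S_Lp that by blast
    show "?T g \<in> borel_measurable \<mu>" if "g \<in> Lp_space \<mu> p" for g
      using T_eq[OF \<open>1 \<le> p\<close> that] sum_op_measurable by simp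
    show "Lp_norm \<mu> p (?T g) \<le> K * Lp_norm \<mu> p g" if "g \<in> Lp_space \<mu> p" for g
      using T_le[OF \<open>1 \<le> p\<close> that] .
    fix s assume s: "s \<in> ?S"
    have f_int: "integrable \<mu> f" and s_int: "integrable \<mu> s"
      using Lp_space_integrable that S_Lp s by blast+
    have "?T (\<lambda>x. f x - s x) = sum_op \<mu> E (\<lambda>x. f x - s x)"
      unfolding L2_projector_def
      using E f_int s_int by (intro L2_projection_unique integrable_mult_E) auto
    also have "\<dots> = (\<lambda>x. sum_op \<mu> E f x - sum_op \<mu> E s x)"
      using f_int s_int by (intro sum_op_diff integrable_mult_E)
    finally show "?T (\<lambda>x. f x - s x) = (\<lambda>x. ?T f x - s x)"
      using E(3)[OF s] T_eq[OF that] by simp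
  qed
  show ?thesis
  proof (rule exI[of _ \<infinity>], intro conjI)
    show "\<exists>K'\<le>Lp_opnorm \<mu> \<infinity> ?T. \<forall>p\<ge>1. \<forall>f\<in>Lp_space \<mu> p.
        Lp_norm \<mu> p (\<lambda>x. f x - ?T f x) \<le> (1 + K') * Lp_dist \<mu> p f ?S"
      using quasi_optimal by (intro exI[of _ K]) (auto simp: K_def)
  qed (use max K_finite in \<open>auto simp: K_def\<close>)
qed

end
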